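(* Assume $\mathcal{C}\subseteq\mathsf{Par}$ is regularly linked, and let $m>0$ be an integer, $I$ a nonempty finite set, $\pi:I\to\mathsf{Par}_{\le m}$, $a\mapsto\pi_a$, an injective map, and $X,X'\subseteq I^+$ regular languages such that $\pi^\bullet(\mathsf{avoid}(\mathsf{Seq}(I,\pi),X,X'))=\mathcal{C}$. Let $M=(Q,I,\delta,s,F)$ be a DFA recognizing $I^*XI^*\cup X'I^*$ (so $s\in Q\setminus F$, since $\varepsilon\notin L(M)$). For $v\in Q\setminus F$ define $$\mathcal{C}^{(v)}:=\pi^\bullet\big(\mathsf{Seq}(I,\pi)\cap (L(M_v)^c)^{\wedge}\big).$$ Then $\mathcal{C}^{(s)}=\mathcal{C}$, and we have the system of $q$-difference equations $$f_{\mathcal{C}^{(v)}}(x,q)=\sum_{u\in Q\setminus F}\Bigg(\sum_{\substack{a\in I\\ u=\delta(v,a)}}x^{\ell(\pi_a)}q^{|\pi_a|}\Bigg)f_{\mathcal{C}^{(u)}}(xq^m,q)\qquad(v\in Q\setminus F).$$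
   Context: A partition is a finite weakly decreasing sequence $\lambda=(\lambda_1,\dots,\lambda_\ell)$ of positive integers (possibly empty); $\ell(\lambda)=\ell$, $|\lambda|=\sum_i\lambda_i$. $\mathsf{Par}$ is the set of all partitions, $\emptyset_{\mathsf{Par}}$ the empty partition, $\mathsf{Par}_{\le m}$ the set of partitions all of whose parts are $\le m$. For $\mathcal{C}\subseteq\mathsf{Par}$, $f_{\mathcal{C}}(x,q)=\sum_{\lambda\in\mathcal{C}}x^{\ell(\lambda)}q^{|\lambda|}$. $\lambda\oplus\mu$ is the partition whose multiset of parts is the multiset union of those of $\lambda$ and $\mu$. $\phi_+((\lambda_1,\dots,\lambda_\ell))=(\lambda_1+1,\dots,\lambda_\ell+1)$. $I^*$ is the set of finite words over $I$, $\varepsilon$ the empty word, $I^+=I^*\setminus\{\varepsilon\}$; products of languages are by concatenation, and $A^c=I^*\setminus A$. A DFA over $I$ is $M=(Q,I,\delta,s,F)$ with $Q$ a finite set, $\delta:Q\times I\to Q$, $s\in Q$, $F\subseteq Q$; $\hat\delta:Q\times I^*\to Q$ is the usual extension ($\hat\delta(q,\varepsilon)=q$, $\hat\delta(q,wa)=\delta(\hat\delta(q,w),a)$), and $M$ recognizes $L(M)=\{w\in I^*\mid\hat\delta(s,w)\in F\}$. A language is regular if some DFA recognizes it. $M_v=(Q,I,\delta,v,F)$ is $M$ with start state replaced by $v$. $\mathsf{Seq}(I)$ is the set of infinite sequences $(i_1,i_2,\dots)$ in $I$. For $A\subseteq I^*$, $A^{\wedge}=\{(i_j)_{j\ge1}\in\mathsf{Seq}(I)\mid\forall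 n\ge1,\ i_1\cdots i_n\in A\}$. For $\pi:I\to\mathsf{Par}_{\le m}$, $\mathsf{Seq}(I,\pi)$ is the set of $(i_1,i_2,\dots)\in\mathsf{Seq}(I)$ with $\pi(i_j)\ne\emptyset_{\mathsf{Par}}$ for only finitely many $j$, and $\pi^\bullet(i_1,i_2,i_3,\dots)=\pi(i_1)\oplus\phi_+^m(\pi(i_2))\oplus\phi_+^{2m}(\pi(i_3))\oplus\cdots$. An infinite sequence matches a word $j_1\cdots j_n$ ($n\ge1$) if the word occurs as a block of consecutive entries; it begins with the word if the word is its initial block. $\mathsf{avoid}(S,X,X')$ is the set of $\vec{i}\in S$ that match no word of $X$ and begin with no word of $X'$. $\mathcal{C}$ is regularly linked if data $(m,I,\pi,X,X')$ as in the claim exist. *)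

theory Defs
  imports "HOL-Computational_Algebra.Formal_Power_Series" "HOL-Library.Multiset"
    "HOL-Library.FuncSet"
begin

section \<open>Partitions\<close>

type_synonym part = "nat list"

definition Par :: "part set" where
  "Par = {p. sorted_wrt (\<ge>) p \<and> (\<forall>k\<in>set p. 0 < k)}"

definition Par_le :: "nat \<Rightarrow> part set" where
  "Par_le m = {p \<in> Par. \<forall>k\<in>set p. k \<le> m}"

definition partition_of_mset :: "nat multiset \<Rightarrow> part" where
  "partition_of_mset A = rev (sorted_list_of_multiset A)"

definition oplus :: "part \<Rightarrow> part \<Rightarrow> part" (infixl \<open>\<oplus>\<close> 65) where
  "p \<oplus> r = partition_of_mset (mset p + mset r)"

text \<open>The infinite sum \<open>\<mu> 0 \<oplus> \<mu> 1 \<oplus> \<mu> 2 \<oplus> \<dots>\<close>; it is meaningful only if all but finitely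
  many \<open>\<mu> j\<close> are empty, see \<open>oplus_seq_eq_finite\<close> below.\<close>

definition oplus_seq :: "(nat \<Rightarrow> part) \<Rightarrow> part" where
  "oplus_seq \<mu> = partition_of_mset (\<Sum>j | \<mu> j \<noteq> []. mset (\<mu> j))"

definition phi_plus :: "part \<Rightarrow> part" where
  "phi_plus p = map Suc p"

lemma mset_partition_of_mset [simp]: "mset (partition_of_mset A) = A"
  by (simp add: partition_of_mset_def)

lemma partition_of_mset_in_Par: "0 \<notin># A \<Longrightarrow> partition_of_mset A \<in> Par"
  unfolding Par_def partition_of_mset_def
  by (auto simp: sorted_wrt_rev intro: gr0I)

lemma oplus_seq_eq_finite:
  assumes "\<And>j. n \<le> j \<Longrightarrow> \<mu> j = []"
  shows "oplus_seq \<mu> = foldl (\<oplus>) [] (map \<mu> [0..<n])"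
proof -
  have "(\<Sum>j | \<mu> j \<noteq> []. mset (\<mu> j)) = (\<Sum>j<n. mset (\<mu> j))"
    using assms by (intro sum.mono_neutral_left) (auto simp: not_le[symmetric])
  moreover have "foldl (\<oplus>) [] (map \<mu> [0..<k]) = partition_of_mset (\<Sum>j<k. mset (\<mu> j))" for k
    by (induction k) (simp_all add: oplus_def, simp add: partition_of_mset_def)
  ultimately show ?thesis by (simp add: oplus_seq_def)
qed


section \<open>Generating functions\<close>

text \<open>The ring \<open>\<int>[[x, q]]\<close> is represented as \<open>\<int>[[q]][[x]]\<close>.\<close>

abbreviation var_x :: "int fps fps" where "var_x \<equiv> fps_X"
abbreviation var_q :: "int fps fps" where "var_q \<equiv> fps_const fps_X"

definition gen_fun :: "part set \<Rightarrow> int fps fps" where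
  "gen_fun C = Abs_fps (\<lambda>k. Abs_fps (\<lambda>n. int (card {p \<in> C. length p = k \<and> sum_list p = n})))"

text \<open>For sets of partitions the cardinalities in \<open>gen_fun_def\<close> are those of finite sets, and
  \<open>gen_fun\<close> is the formal sum of the monomials of the elements.\<close>

lemma finite_Par_length_sum: "finite {p \<in> Par. length p = k \<and> sum_list p = n}"
proof (rule finite_subset)
  show "{p \<in> Par. length p = k \<and> sum_list p = n} \<subseteq> {p. set p \<subseteq> {..n} \<and> length p = k}"
    using member_le_sum_list by fastforce
qed (simp add: finite_lists_length_eq)

lemma gen_fun_finite:
  assumes "finite C"
  shows "gen_fun C = (\<Sum>p\<in>C. var_x ^ length p * var_q ^ sum_list p)"
proof -
  have 1: "fps_nth (fps_nth (var_x ^ length p * var_q ^ sum_list p) k) n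
      = (if length p = k \<and> sum_list p = n then 1 else 0)" for p k n
    by (auto simp: fps_const_power fps_X_power_mult_nth fps_X_power_nth)
  have "fps_nth (fps_nth (\<Sum>p\<in>C. var_x ^ length p * var_q ^ sum_list p) k) n
      = (\<Sum>p\<in>C. if length p = k \<and> sum_list p = n then 1 else 0)" for k n
    by (simp only: fps_sum_nth 1)
  also have "\<dots> k n = fps_nth (fps_nth (gen_fun C) k) n" for k n
    using assms by (simp add: gen_fun_def sum.If_cases Int_def)
  finally show ?thesis by (simp add: fps_eq_iff)
qed


section \<open>Automata and regular languages\<close>

record ('q, 'a) dfa =
  states :: "'q set"
  alphabet :: "'a set"
  trans :: "'q \<Rightarrow> 'a \<Rightarrow> 'q"
  start :: 'q
  accept :: "'q set"

definition is_dfa :: "('q, 'a) dfa \<Rightarrow> bool" where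
  "is_dfa M \<longleftrightarrow> finite (states M) \<and>
     (\<forall>q\<in>states M. \<forall>a\<in>alphabet M. trans M q a \<in> states M) \<and>
     start M \<in> states M \<and> accept M \<subseteq> states M"

definition trans_hat :: "('q, 'a) dfa \<Rightarrow> 'q \<Rightarrow> 'a list \<Rightarrow> 'q" where
  "trans_hat M q w = foldl (trans M) q w"

definition lang :: "('q, 'a) dfa \<Rightarrow> 'a list set" where
  "lang M = {w \<in> lists (alphabet M). trans_hat M (start M) w \<in> accept M}"

text \<open>States are taken in \<^typ>\<open>nat\<close>, which is no restriction since every finite state set can be
  renamed injectively into \<^typ>\<open>nat\<close>.\<close>

definition regular_lang :: "'a set \<Rightarrow> 'a list set \<Rightarrow> bool" where
  "regular_lang I A \<longleftrightarrow> (\<exists>M :: (nat, 'a) dfa. is_dfa M \<and> alphabet M = I \<and> lang M = A)"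

definition conc :: "'a list set \<Rightarrow> 'a list set \<Rightarrow> 'a list set" (infixr \<open>\<odot>\<close> 75) where
  "A \<odot> B = {u @ v | u v. u \<in> A \<and> v \<in> B}"


section \<open>Infinite sequences\<close>

text \<open>Sequences are indexed from 0: the entry written \<open>i\<^sub>j\<close> with \<open>j \<ge> 1\<close> is \<open>i (j - 1)\<close>.\<close>

definition Seq :: "'a set \<Rightarrow> (nat \<Rightarrow> 'a) set" where
  "Seq I = {i. \<forall>j. i j \<in> I}"

definition seqs_with_prefixes_in :: "'a set \<Rightarrow> 'a list set \<Rightarrow> (nat \<Rightarrow> 'a) set" where
  "seqs_with_prefixes_in I A = {i \<in> Seq I. \<forall>n\<ge>1. map i [0..<n] \<in> A}"

definition Seq_pi :: "'a set \<Rightarrow> ('a \<Rightarrow> part) \<Rightarrow> (nat \<Rightarrow> 'a) set" where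
  "Seq_pi I \<pi> = {i \<in> Seq I. finite {j. \<pi> (i j) \<noteq> []}}"

definition pi_bullet :: "nat \<Rightarrow> ('a \<Rightarrow> part) \<Rightarrow> (nat \<Rightarrow> 'a) \<Rightarrow> part" where
  "pi_bullet m \<pi> i = oplus_seq (\<lambda>j. (phi_plus ^^ (j * m)) (\<pi> (i j)))"

definition matches :: "(nat \<Rightarrow> 'a) \<Rightarrow> 'a list \<Rightarrow> bool" where
  "matches i w \<longleftrightarrow> (\<exists>k. map i [k..<k + length w] = w)"

definition begins_with :: "(nat \<Rightarrow> 'a) \<Rightarrow> 'a list \<Rightarrow> bool" where
  "begins_with i w \<longleftrightarrow> map i [0..<length w] = w"

definition avoid :: "(nat \<Rightarrow> 'a) set \<Rightarrow> 'a list set \<Rightarrow> 'a list set \<Rightarrow> (nat \<Rightarrow> 'a) set" where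
  "avoid S X X' = {i \<in> S. (\<forall>w\<in>X. \<not> matches i w) \<and> (\<forall>w\<in>X'. \<not> begins_with i w)}"

definition class_at :: "nat \<Rightarrow> ('a \<Rightarrow> part) \<Rightarrow> ('q, 'a) dfa \<Rightarrow> 'q \<Rightarrow> part set" where
  "class_at m \<pi> M v = pi_bullet m \<pi> ` (Seq_pi (alphabet M) \<pi> \<inter>
     seqs_with_prefixes_in (alphabet M) (lists (alphabet M) - lang (M\<lparr>start := v\<rparr>)))"

end

theory Submission
  imports Defs "HOL-Library.Disjoint_Sets"
begin

text \<open>The class of a state splits according to the first letter \<open>a\<close> of the sequence: its members are
  the partitions \<open>\<pi>\<^sub>a \<oplus> \<phi>\<^sub>+\<^sup>m(\<mu>)\<close> with \<open>\<mu>\<close> in the class of the next state. The parts of \<open>\<pi>\<^sub>a\<close> are at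
  most \<open>m\<close> and those of the shifted partition exceed \<open>m\<close>, so \<open>a\<close> and \<open>\<mu>\<close> can be recovered and the
  union is disjoint. Shifting \<open>\<mu>\<close> by \<open>m\<close> adds \<open>m\<close> to its size for each part, which is the
  substitution of \<open>x q\<^sup>m\<close> for \<open>x\<close>.\<close>

section \<open>Gluing a partition below a shifted one\<close>

definition glue :: "nat \<Rightarrow> part \<Rightarrow> part \<Rightarrow> part" where
  "glue m r p = r \<oplus> (phi_plus ^^ m) p"

lemma phi_plus_power: "(phi_plus ^^ k) p = map (\<lambda>x. x + k) p"
  by (induction k) (auto simp: phi_plus_def)

lemma mset_oplus [simp]: "mset (p \<oplus> r) = mset p + mset r"
  by (simp add: oplus_def)

lemma mset_glue: "mset (glue m r p) = mset r + image_mset (\<lambda>x. x + m) (mset p)"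
  by (simp add: glue_def phi_plus_power)

lemma length_glue: "length (glue m r p) = length r + length p"
  using mset_glue[of m r p, THEN arg_cong, of size] by simp

lemma sum_list_glue: "sum_list (glue m r p) = sum_list r + (sum_list p + m * length p)"
proof -
  have "sum_list (glue m r p) = sum_mset (mset r) + sum_mset (mset (map (\<lambda>x. x + m) p))"
    by (metis mset_glue mset_map sum_mset.union sum_mset_sum_list)
  also have "sum_mset (mset (map (\<lambda>x. x + m) p)) = sum_list p + m * length p"
    by (simp only: sum_mset_sum_list) (induction p, auto)
  finally show ?thesis by (simp add: sum_mset_sum_list)
qed

lemma Par_eq_partition_of_mset:
  assumes "p \<in> Par"
  shows "p = partition_of_mset (mset p)"
proof -
  have "sorted (rev p)"
    using assms by (simp add: Par_def sorted_wrt_rev)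
  then show ?thesis
    by (metis partition_of_mset_def mset_rev rev_rev_ident sorted_list_of_multiset_mset
        sorted_sort_id)
qed

text \<open>A member of \<open>Par\<close> is the decreasing listing of its multiset of parts, so
  equality of partitions can be decided on multisets, where parts can be filtered and
  cancelled.\<close>

lemma Par_eq_iff_mset: "p \<in> Par \<Longrightarrow> r \<in> Par \<Longrightarrow> p = r \<longleftrightarrow> mset p = mset r"
  by (metis Par_eq_partition_of_mset)

text \<open>Parts of \<open>p\<close> are positive, so after the shift they exceed \<open>m\<close>,
  while those of \<open>r\<close> are at most \<open>m\<close>: the threshold \<open>m\<close>
  separates the two.\<close>

lemma filter_le_mset_glue:
  assumes "r \<in> Par_le m" "p \<in> Par"
  shows "filter_mset (\<lambda>x. x \<le> m) (mset (glue m r p)) = mset r"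
proof -
  have "filter_mset (\<lambda>x. x \<le> m) (mset r) = mset r"
    using assms by (auto simp: Par_le_def filter_mset_eq_conv)
  moreover have "filter_mset (\<lambda>x. x \<le> m) (image_mset (\<lambda>x. x + m) (mset p)) = {#}"
    using assms by (induction p) (auto simp: Par_def)
  ultimately show ?thesis by (simp add: mset_glue)
qed

lemma glue_inject:
  assumes "r \<in> Par_le m" "r' \<in> Par_le m" "p \<in> Par" "p' \<in> Par" "glue m r p = glue m r' p'"
  shows "r = r'" and "p = p'"
proof -
  have "mset r = mset r'"
    using assms filter_le_mset_glue by metis
  then show "r = r'"
    using assms Par_eq_iff_mset by (auto simp: Par_le_def)
  \<comment> \<open>The lower parts now cancel; the shift by \<open>m\<close> is injective on
    numbers, hence on multisets of numbers.\<close>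
  then have "image_mset (\<lambda>x. x + m) (mset p) = image_mset (\<lambda>x. x + m) (mset p')"
    using assms(5) mset_glue by (metis add_left_cancel)
  then have "mset p = mset p'"
    using multiset.inj_map[of "\<lambda>x. x + m"] by (simp add: inj_on_def)
  then show "p = p'"
    using assms Par_eq_iff_mset by blast
qed


section \<open>Generating functions\<close>

lemma gen_fun_nth:
  "fps_nth (fps_nth (gen_fun C) k) n = int (card {p \<in> C. length p = k \<and> sum_list p = n})"
  by (simp add: gen_fun_def)

lemma finite_subset_Par_length_sum:
  "C \<subseteq> Par \<Longrightarrow> finite {p \<in> C. length p = k \<and> sum_list p = n}"
  by (rule finite_subset[OF _ finite_Par_length_sum[of k n]]) auto

text \<open>Coefficients are cardinalities, and their additivity over disjoint sets rests on
  finiteness. This comes from \<open>A j \<subseteq> Par\<close>: only finitely many partitions have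
  a given length and size.\<close>

lemma gen_fun_UNION:
  assumes "finite J" "\<And>j. j \<in> J \<Longrightarrow> A j \<subseteq> Par" "disjoint_family_on A J"
  shows "gen_fun (\<Union>j\<in>J. A j) = (\<Sum>j\<in>J. gen_fun (A j))"
proof -
  have "card {p \<in> (\<Union>j\<in>J. A j). length p = k \<and> sum_list p = n}
      = (\<Sum>j\<in>J. card {p \<in> A j. length p = k \<and> sum_list p = n})" for k n
  proof -
    have "{p \<in> (\<Union>j\<in>J. A j). length p = k \<and> sum_list p = n}
        = (\<Union>j\<in>J. {p \<in> A j. length p = k \<and> sum_list p = n})"
      by auto
    then show ?thesis
      using assms(1,3) finite_subset_Par_length_sum[OF assms(2)]
      by (simp only:) (intro card_UN_disjoint, auto simp: disjoint_family_on_def)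
  qed
  then show ?thesis
    by (simp add: fps_eq_iff gen_fun_nth fps_sum_nth)
qed

lemma gen_fun_glue:
  assumes "r \<in> Par_le m" "D \<subseteq> Par"
  shows "gen_fun (glue m r ` D) = (var_x ^ length r * var_q ^ sum_list r) *
    (gen_fun D oo (var_x * var_q ^ m))"
proof -
  \<comment> \<open>\<open>oo\<close> substitutes for the outer variable only. As
    \<open>x q^m\<close> is the constant \<open>q^m\<close> times \<open>x\<close>, the coefficient
    of \<open>x^k\<close> is multiplied by \<open>q^(m k)\<close>.\<close>
  have compose: "fps_nth (gen_fun D oo (var_x * var_q ^ m)) k
      = fps_X ^ (m * k) * fps_nth (gen_fun D) k" for k
  proof -
    have "var_x * var_q ^ m = fps_const (fps_X ^ m) * var_x"
      by (simp add: fps_const_power mult.commute)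
    then show ?thesis
      by (simp only: fps_compose_linear power_mult fps_nth_Abs_fps)
  qed
  \<comment> \<open>Both sides are compared coefficientwise. Injectivity of \<open>glue m r\<close>
    turns a count over the image into a count over \<open>D\<close>.\<close>
  have "card {p \<in> glue m r ` D. length p = k \<and> sum_list p = n} =
      card {p \<in> D. length r + length p = k \<and> sum_list r + (sum_list p + m * length p) = n}" for k n
  proof -
    have "inj_on (glue m r) D"
      using glue_inject(2)[OF assms(1) assms(1)] assms(2) by (intro inj_onI) blast
    moreover have "{p \<in> glue m r ` D. length p = k \<and> sum_list p = n} = glue m r `
        {p \<in> D. length r + length p = k \<and> sum_list r + (sum_list p + m * length p) = n}"
      by (auto simp: length_glue sum_list_glue)
    ultimately show ?thesis
      using card_image[OF inj_on_subset] by (metis (no_types, lifting) mem_Collect_eq subsetI)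
  qed
  moreover have "fps_nth (fps_nth ((var_x ^ length r * var_q ^ sum_list r) *
      (gen_fun D oo (var_x * var_q ^ m))) k) n = int (card {p \<in> D. length r + length p = k \<and>
        sum_list r + (sum_list p + m * length p) = n})" for k n
  proof -
    let ?l = "length r" and ?s = "sum_list r"
    let ?F = "gen_fun D oo (var_x * var_q ^ m)"
    have "(var_x ^ ?l * var_q ^ ?s) * ?F = var_x ^ ?l * (fps_const (fps_X ^ ?s) * ?F)"
      by (simp only: fps_const_power mult.assoc)
    \<comment> \<open>Powers of a variable shift coefficients. The zero cases are those where a
      subtraction on \<open>nat\<close> would truncate: there no \<open>p\<close> is counted, and
      elsewhere the subtractions are exact.\<close>
    then have "fps_nth (fps_nth ((var_x ^ ?l * var_q ^ ?s) * ?F) k) n =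
      (if k < ?l then 0 else if n < ?s then 0 else if n - ?s < m * (k - ?l) then 0
       else fps_nth (fps_nth (gen_fun D) (k - ?l)) (n - ?s - m * (k - ?l)))"
      by (simp only: fps_X_power_mult_nth fps_mult_left_const_nth compose if_distribR fps_zero_nth
          if_distrib[of "\<lambda>f. fps_nth f n"])
    also have "\<dots> = int (card {p \<in> D. ?l + length p = k \<and> ?s + (sum_list p + m * length p) = n})"
      (is "_ = int (card ?A)")
    proof (cases "k < ?l \<or> n < ?s \<or> n - ?s < m * (k - ?l)")
      case True
      then have "?A = {}" by auto
      then have "card ?A = 0" by (simp only: card.empty)
      then show ?thesis using True by auto
    next
      case False
      then have "?A = {p \<in> D. length p = k - ?l \<and> sum_list p = n - ?s - m * (k - ?l)}"
        by auto
      then show ?thesis using False by (simp add: gen_fun_nth)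
    qed
    finally show ?thesis .
  qed
  ultimately show ?thesis
    by (simp only: fps_eq_iff gen_fun_nth simp_thms)
qed


section \<open>Splitting off the first letter\<close>

text \<open>\<open>case_nat a i\<close> is the sequence \<open>i\<close> with \<open>a\<close> put
  in front. Away from position 0, its nonempty entries are those of \<open>i\<close> moved by one,
  so finiteness is preserved both ways.\<close>

lemma Seq_pi_case_nat:
  "case_nat a i \<in> Seq_pi I \<pi> \<longleftrightarrow> a \<in> I \<and> i \<in> Seq_pi I \<pi>"
proof -
  have "{j. \<pi> (case_nat a i j) \<noteq> []} - {0} = Suc ` {j. \<pi> (i j) \<noteq> []}"
  proof (rule set_eqI)
    show "j \<in> {j. \<pi> (case_nat a i j) \<noteq> []} - {0} \<longleftrightarrow> j \<in> Suc ` {j. \<pi> (i j) \<noteq> []}" for j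
      by (cases j) auto
  qed
  moreover have "finite (Suc ` {j. \<pi> (i j) \<noteq> []}) \<longleftrightarrow> finite {j. \<pi> (i j) \<noteq> []}"
    by (simp add: finite_image_iff)
  ultimately have "finite {j. \<pi> (case_nat a i j) \<noteq> []} \<longleftrightarrow> finite {j. \<pi> (i j) \<noteq> []}"
    by (metis finite_Diff_insert Diff_empty)
  moreover have "case_nat a i \<in> Seq I \<longleftrightarrow> a \<in> I \<and> i \<in> Seq I"
    by (simp add: Seq_def split: nat.splits) (metis nat.case not0_implies_Suc)
  ultimately show ?thesis by (auto simp: Seq_pi_def)
qed

lemma pi_bullet_in_Par:
  assumes "\<pi> \<in> I \<rightarrow> Par" "i \<in> Seq_pi I \<pi>"
  shows "pi_bullet m \<pi> i \<in> Par"
proof -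
  have "0 \<notin> set ((phi_plus ^^ (j * m)) (\<pi> (i j)))" for j
    using assms by (force simp: phi_plus_power Seq_pi_def Seq_def Par_def Pi_iff)
  moreover have "finite {j. (phi_plus ^^ (j * m)) (\<pi> (i j)) \<noteq> []}"
    using assms by (simp add: phi_plus_power Seq_pi_def)
  ultimately show ?thesis
    unfolding pi_bullet_def oplus_seq_def
    by (intro partition_of_mset_in_Par) (auto simp: set_mset_sum)
qed

text \<open>Entry \<open>j\<close> of \<open>i\<close> becomes entry \<open>Suc j\<close>, whose
  shift \<open>Suc j * m\<close> is \<open>j * m\<close> plus one further \<open>m\<close>; this
  common \<open>m\<close> comes out of the sum.\<close>

lemma pi_bullet_case_nat:
  assumes "i \<in> Seq_pi I \<pi>"
  shows "pi_bullet m \<pi> (case_nat a i) = glue m (\<pi> a) (pi_bullet m \<pi> i)"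
proof -
  \<comment> \<open>With \<open>N\<close> beyond all nonempty entries, both sums can be extended to
    initial segments, the added terms being empty multisets.\<close>
  obtain N where N: "\<And>j. \<pi> (i j) \<noteq> [] \<Longrightarrow> j < N"
    using assms by (auto simp: Seq_pi_def finite_nat_set_iff_bounded)
  have N': "j < Suc N" if "\<pi> (case_nat a i j) \<noteq> []" for j
    using that by (cases j) (auto intro: N)
  have i: "(\<Sum>j | (phi_plus ^^ (j * m)) (\<pi> (i j)) \<noteq> []. mset ((phi_plus ^^ (j * m)) (\<pi> (i j))))
      = (\<Sum>j<N. image_mset (\<lambda>x. x + j * m) (mset (\<pi> (i j))))"
    by (intro sum.mono_neutral_cong_left) (auto simp: phi_plus_power intro: N)
  have "(\<Sum>j | (phi_plus ^^ (j * m)) (\<pi> (case_nat a i j)) \<noteq> [].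
        mset ((phi_plus ^^ (j * m)) (\<pi> (case_nat a i j))))
      = (\<Sum>j<Suc N. image_mset (\<lambda>x. x + j * m) (mset (\<pi> (case_nat a i j))))"
    by (intro sum.mono_neutral_cong_left) (auto simp: phi_plus_power dest: N')
  also have "\<dots> = mset (\<pi> a) + (\<Sum>j<N. image_mset (\<lambda>x. x + Suc j * m) (mset (\<pi> (i j))))"
    by (simp add: sum.lessThan_Suc_shift del: sum.lessThan_Suc)
  also have "(\<Sum>j<N. image_mset (\<lambda>x. x + Suc j * m) (mset (\<pi> (i j)))) =
      image_mset (\<lambda>x. x + m) (\<Sum>j<N. image_mset (\<lambda>x. x + j * m) (mset (\<pi> (i j))))"
    by (induction N) (simp_all add: multiset.map_comp o_def add_ac)
  finally show ?thesis
    by (simp only: pi_bullet_def oplus_seq_def i glue_def oplus_def phi_plus_power[of m] mset_map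
        mset_partition_of_mset)
qed

text \<open>Prefixes of a sequence over the alphabet are words automatically, so only acceptance
  from \<open>v\<close> remains. \<open>Suc n\<close> reflects that the empty prefix is not
  tested.\<close>

lemma seqs_with_prefixes_in_not_lang:
  "seqs_with_prefixes_in (alphabet M) (lists (alphabet M) - lang (M\<lparr>start := v\<rparr>))
    = {i \<in> Seq (alphabet M). \<forall>n. trans_hat M v (map i [0..<Suc n]) \<notin> accept M}"
proof -
  have "trans_hat (M\<lparr>start := v\<rparr>) v w = trans_hat M v w" for w
    by (simp add: trans_hat_def)
  then show ?thesis
    unfolding seqs_with_prefixes_in_def lang_def Seq_def
    by (auto simp: in_lists_conv_set Suc_le_eq gr0_conv_Suc)
qed

text \<open>Once \<open>a\<close> is read, the remaining prefixes of \<open>i\<close> include the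
  empty one, which the condition on \<open>i\<close> alone leaves out. It gives the separate
  condition on \<open>trans M v a\<close>.\<close>

lemma prefixes_not_accepted_case_nat:
  "(\<forall>n. trans_hat M v (map (case_nat a i) [0..<Suc n]) \<notin> accept M) \<longleftrightarrow>
    trans M v a \<notin> accept M \<and>
    (\<forall>n. trans_hat M (trans M v a) (map i [0..<Suc n]) \<notin> accept M)"
proof -
  have all_nat_conv: "(\<forall>n. P n) \<longleftrightarrow> P 0 \<and> (\<forall>n. P (Suc n))" for P :: "nat \<Rightarrow> bool"
    by (metis not0_implies_Suc)
  have "map (case_nat a i) [0..<Suc n] = a # map i [0..<n]" for n
    by (simp add: map_upt_Suc del: upt_Suc)
  then have "trans_hat M v (map (case_nat a i) [0..<Suc n]) =
      trans_hat M (trans M v a) (map i [0..<n])" for n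
    by (simp add: trans_hat_def del: upt_Suc)
  then show ?thesis
    using all_nat_conv[of "\<lambda>n. trans_hat M (trans M v a) (map i [0..<n]) \<notin> accept M"]
    by (simp add: trans_hat_def del: upt_Suc)
qed

lemma class_at_subset_Par:
  "\<pi> \<in> alphabet M \<rightarrow> Par \<Longrightarrow> class_at m \<pi> M v \<subseteq> Par"
  by (auto simp: class_at_def intro: pi_bullet_in_Par)

lemma class_at_unfold:
  assumes "is_dfa M" "v \<in> states M"
  shows "class_at m \<pi> M v =
    (\<Union>a\<in>{a \<in> alphabet M. trans M v a \<in> states M - accept M}.
      glue m (\<pi> a) ` class_at m \<pi> M (trans M v a))"
proof -
  \<comment> \<open>The decomposition by first letter is done on sequences; \<open>pi_bullet\<close>
    is applied to the resulting union at the end.\<close>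
  define S where "S v = {i \<in> Seq_pi (alphabet M) \<pi>.
    \<forall>n. trans_hat M v (map i [0..<Suc n]) \<notin> accept M}" for v
  have class_at: "class_at m \<pi> M v = pi_bullet m \<pi> ` S v" for v
    unfolding class_at_def S_def seqs_with_prefixes_in_not_lang
    by (rule arg_cong[where f = "image _"]) (auto simp: Seq_pi_def)
  have S: "case_nat a i \<in> S v \<longleftrightarrow> a \<in> alphabet M \<and> trans M v a \<in> states M - accept M \<and>
      i \<in> S (trans M v a)" for a i
    using assms by (auto simp: S_def prefixes_not_accepted_case_nat Seq_pi_case_nat is_dfa_def
        simp del: upt_Suc)
  have "S v = (\<Union>a\<in>{a \<in> alphabet M. trans M v a \<in> states M - accept M}.
      case_nat a ` S (trans M v a))"
  proof (intro equalityI subsetI)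
    fix i assume "i \<in> S v"
    moreover have "i = case_nat (i 0) (\<lambda>j. i (Suc j))"
      by (auto simp: fun_eq_iff split: nat.splits)
    ultimately show "i \<in> (\<Union>a\<in>{a \<in> alphabet M. trans M v a \<in> states M - accept M}.
      case_nat a ` S (trans M v a))"
      using S by (metis (no_types, lifting) UN_I imageI mem_Collect_eq)
  qed (auto simp: S)
  moreover have "pi_bullet m \<pi> (case_nat a i) = glue m (\<pi> a) (pi_bullet m \<pi> i)"
    if "i \<in> S u" for a i u
    using that pi_bullet_case_nat by (auto simp: S_def)
  ultimately show ?thesis
    unfolding class_at by (auto simp: image_UN image_image intro!: SUP_cong)
qed


section \<open>The initial state\<close>

lemma ex_prefix_in_conc_lists:
  assumes "i \<in> Seq I" "X \<subseteq> lists I - {[]}"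
  shows "(\<exists>n\<ge>1. map i [0..<n] \<in> X \<odot> lists I) \<longleftrightarrow> (\<exists>w\<in>X. begins_with i w)"
proof
  assume "\<exists>n\<ge>1. map i [0..<n] \<in> X \<odot> lists I"
  then obtain n w z where w: "w \<in> X" "map i [0..<n] = w @ z"
    by (auto simp: conc_def)
  have "length w \<le> n"
    using w(2)[THEN arg_cong, of length] by simp
  then have "map i [0..<length w] = w"
    using w(2)[THEN arg_cong, of "take (length w)"] by (simp add: take_map)
  then show "\<exists>w\<in>X. begins_with i w"
    using w by (auto simp: begins_with_def)
next
  assume "\<exists>w\<in>X. begins_with i w"
  then obtain w where w: "w \<in> X" "map i [0..<length w] = w"
    by (auto simp: begins_with_def)
  have "w @ [] \<in> X \<odot> lists I"
    unfolding conc_def using w(1) by blast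
  then have "map i [0..<length w] \<in> X \<odot> lists I"
    by (simp add: w(2))
  \<comment> \<open>Words of \<open>X\<close> are nonempty, so the prefix found has positive length,
    as the range of \<open>n\<close> requires.\<close>
  moreover have "length w \<ge> 1"
    using w(1) assms(2) by (auto simp: Suc_le_eq)
  ultimately show "\<exists>n\<ge>1. map i [0..<n] \<in> X \<odot> lists I"
    by blast
qed

text \<open>A block \<open>w\<close> at position \<open>k\<close> ends the prefix of length
  \<open>k + length w\<close>; conversely, a factorization \<open>y @ w @ z\<close> of a prefix puts
  \<open>w\<close> at position \<open>length y\<close>.\<close>

lemma ex_prefix_in_lists_conc_lists:
  assumes "i \<in> Seq I" "X \<subseteq> lists I - {[]}"
  shows "(\<exists>n\<ge>1. map i [0..<n] \<in> lists I \<odot> X \<odot> lists I) \<longleftrightarrow> (\<exists>w\<in>X. matches i w)"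
proof
  assume "\<exists>n\<ge>1. map i [0..<n] \<in> lists I \<odot> X \<odot> lists I"
  then obtain n y w z where w: "w \<in> X" "map i [0..<n] = y @ w @ z"
    by (auto simp: conc_def)
  have "length y + length w \<le> n"
    using w(2)[THEN arg_cong, of length] by simp
  then have "map i [length y..<length y + length w] = w"
    using w(2)[THEN arg_cong, of "\<lambda>l. take (length w) (drop (length y) l)"]
    by (simp add: take_map drop_map)
  then show "\<exists>w\<in>X. matches i w"
    using w by (auto simp: matches_def)
next
  assume "\<exists>w\<in>X. matches i w"
  then obtain k w where w: "w \<in> X" "map i [k..<k + length w] = w"
    by (auto simp: matches_def)
  have "map i [0..<k + length w] = map i [0..<k] @ w @ []"
    by (simp add: upt_add_eq_append[of 0 k "length w"] w(2))
  moreover have "map i [0..<k] \<in> lists I"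
    using assms by (auto simp: Seq_def)
  ultimately have "map i [0..<k + length w] \<in> lists I \<odot> X \<odot> lists I"
    unfolding conc_def using w by blast
  moreover have "k + length w \<ge> 1"
    using w(1) assms(2) by (auto simp: Suc_le_eq)
  ultimately show "\<exists>n\<ge>1. map i [0..<n] \<in> lists I \<odot> X \<odot> lists I"
    by blast
qed

text \<open>This turns avoidance of patterns into a condition on prefixes, for the language that
  \<open>M\<close> recognizes in the theorem.\<close>

lemma avoid_eq_seqs_with_prefixes_in:
  assumes "X \<subseteq> lists I - {[]}" "X' \<subseteq> lists I - {[]}"
  shows "avoid (Seq_pi I \<pi>) X X' = Seq_pi I \<pi> \<inter>
    seqs_with_prefixes_in I (lists I - (lists I \<odot> X \<odot> lists I \<union> X' \<odot> lists I))"
proof -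
  have "i \<in> avoid (Seq_pi I \<pi>) X X' \<longleftrightarrow> i \<in> seqs_with_prefixes_in I
      (lists I - (lists I \<odot> X \<odot> lists I \<union> X' \<odot> lists I))" if "i \<in> Seq_pi I \<pi>" for i
  proof -
    have i: "i \<in> Seq I" using that by (simp add: Seq_pi_def)
    then have "map i [0..<n] \<in> lists I" for n
      by (auto simp: Seq_def)
    then show ?thesis
      using that i ex_prefix_in_conc_lists[OF i assms(2)]
        ex_prefix_in_lists_conc_lists[OF i assms(1)]
      unfolding avoid_def seqs_with_prefixes_in_def by blast
  qed
  then show ?thesis by (auto simp: avoid_def)
qed

section \<open>The equations: first letters regrouped by the state they lead to\<close>

theorem theorem3p14:
  fixes C :: "part set" and m :: nat and I :: "'a set" and \<pi> :: "'a \<Rightarrow> part"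
    and X X' :: "'a list set" and M :: "('q, 'a) dfa"
  assumes "C \<subseteq> Par"
    and "0 < m"
    and "finite I" and "I \<noteq> {}"
    and "\<pi> \<in> I \<rightarrow> Par_le m" and "inj_on \<pi> I"
    and "X \<subseteq> lists I - {[]}" and "regular_lang I X"
    and "X' \<subseteq> lists I - {[]}" and "regular_lang I X'"
    and "pi_bullet m \<pi> ` avoid (Seq_pi I \<pi>) X X' = C"
    and "is_dfa M" and "alphabet M = I"
    and "lang M = lists I \<odot> X \<odot> lists I \<union> X' \<odot> lists I"
  shows "start M \<in> states M - accept M \<and>
    class_at m \<pi> M (start M) = C \<and>
    (\<forall>v \<in> states M - accept M.
      gen_fun (class_at m \<pi> M v) =
        (\<Sum>u \<in> states M - accept M.
          (\<Sum>a | a \<in> I \<and> u = trans M v a. var_x ^ length (\<pi> a) * var_q ^ sum_list (\<pi> a)) *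
          (gen_fun (class_at m \<pi> M u) oo (var_x * var_q ^ m))))"
proof (intro conjI ballI)
  have \<pi>: "\<pi> \<in> alphabet M \<rightarrow> Par"
    using assms(5,13) by (auto simp: Par_le_def Pi_iff)
  \<comment> \<open>Every word of \<open>lang M\<close> contains a word of \<open>X\<close> or
    \<open>X'\<close>, hence is nonempty; the run on the empty word ends in the start state.\<close>
  have "[] \<notin> lang M"
    using assms(7,9,14) by (auto simp: conc_def)
  then show "start M \<in> states M - accept M"
    using assms(12) by (auto simp: lang_def trans_hat_def is_dfa_def)
  have "M\<lparr>start := start M\<rparr> = M"
    by simp
  then show "class_at m \<pi> M (start M) = C"
    unfolding class_at_def assms(11)[symmetric] avoid_eq_seqs_with_prefixes_in[OF assms(7,9)]
    by (simp only: assms(13,14))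
  fix v assume v: "v \<in> states M - accept M"
  define J where "J = {a \<in> I. trans M v a \<in> states M - accept M}"
  define mono where "mono a = var_x ^ length (\<pi> a) * var_q ^ sum_list (\<pi> a)" for a
  define G where "G u = gen_fun (class_at m \<pi> M u) oo (var_x * var_q ^ m)" for u
  have J: "finite J" and fin: "finite (states M - accept M)"
    using assms(3,12) by (simp_all add: J_def is_dfa_def)
  note Par = class_at_subset_Par[OF \<pi>]
  have \<pi>_le: "\<pi> a \<in> Par_le m" if "a \<in> J" for a
    using that assms(5) by (auto simp: J_def)
  have "disjoint_family_on (\<lambda>a. glue m (\<pi> a) ` class_at m \<pi> M (trans M v a)) J"
    unfolding disjoint_family_on_def
  proof (intro ballI impI equals0I)
    fix a b p assume ab: "a \<in> J" "b \<in> J" "a \<noteq> b"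
      and "p \<in> glue m (\<pi> a) ` class_at m \<pi> M (trans M v a) \<inter>
        glue m (\<pi> b) ` class_at m \<pi> M (trans M v b)"
    then obtain r s where "r \<in> Par" "s \<in> Par" "glue m (\<pi> a) r = glue m (\<pi> b) s"
      using Par by blast
    then have "\<pi> a = \<pi> b"
      using glue_inject(1) ab \<pi>_le by metis
    then show False
      using assms(6) ab by (auto simp: J_def dest: inj_onD)
  qed
  \<comment> \<open>By the unfolding each piece lies in the class of \<open>v\<close>, which
    consists of partitions.\<close>
  moreover have "glue m (\<pi> a) ` class_at m \<pi> M (trans M v a) \<subseteq> Par" if "a \<in> J" for a
    using class_at_unfold[of M v m \<pi>] Par[of m v] that v assms(12,13) unfolding J_def by blast
  moreover have "class_at m \<pi> M v = (\<Union>a\<in>J. glue m (\<pi> a) ` class_at m \<pi> M (trans M v a))"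
    using class_at_unfold[of M v m \<pi>] v assms(12,13) by (simp add: J_def)
  ultimately have "gen_fun (class_at m \<pi> M v) =
      (\<Sum>a\<in>J. gen_fun (glue m (\<pi> a) ` class_at m \<pi> M (trans M v a)))"
    using gen_fun_UNION[OF J] by simp
  also have "\<dots> = (\<Sum>a\<in>J. mono a * G (trans M v a))"
    using gen_fun_glue \<pi>_le Par by (intro sum.cong) (simp_all add: mono_def G_def)
  also have "\<dots> = (\<Sum>u\<in>states M - accept M. \<Sum>a\<in>{a \<in> J. trans M v a = u}.
      mono a * G (trans M v a))"
    using J fin by (intro sum.group[symmetric]) (auto simp: J_def)
  \<comment> \<open>On the group of \<open>u\<close> the factor \<open>G\<close> is constant and
    comes out of the sum. As \<open>u\<close> is a nonaccepting state, all letters of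
    \<open>I\<close> leading to it lie in \<open>J\<close>.\<close>
  also have "\<dots> = (\<Sum>u\<in>states M - accept M. (\<Sum>a | a \<in> I \<and> u = trans M v a. mono a) * G u)"
    unfolding sum_distrib_right by (intro sum.cong) (auto simp: J_def)
  finally show "gen_fun (class_at m \<pi> M v) = (\<Sum>u\<in>states M - accept M.
      (\<Sum>a | a \<in> I \<and> u = trans M v a. var_x ^ length (\<pi> a) * var_q ^ sum_list (\<pi> a)) *
      (gen_fun (class_at m \<pi> M u) oo (var_x * var_q ^ m)))"
    by (simp add: mono_def G_def)
qed

end
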